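(* Let $G^\sigma$ be a signed graph whose adjacency matrix has all but at most two eigenvalues (counted with multiplicity) equal to $\pm 1$. If the underlying graph $G$ is disconnected and has no isolated edges (no connected component equal to $K_2$), then $G^\sigma$ is the disjoint union of two signed graphs, each of which is switching isomorphic with an unsigned complete graph or with the negative of an unsigned complete graph.
   Context: A signed graph $G^\sigma$ is a finite simple graph $G$ with a signature $\sigma:E(G)\to\{-1,+1\}$; its adjacency matrix $A$ has $A_{uv}=\sigma(\{u,v\})$ for edges and $0$ otherwise. The negative of a signed graph has adjacency matrix $-A$. Switching with respect to a vertex subset $X$ changes the sign of every edge between $X$ and $V\setminus X$; two signed graphs are switching isomorphic if one can be switched into an isomorphic copy of the other. An unsigned graph is regarded as a signed graph with all edges positive. *)

theory Defs
  imports
    "Graph_Theory.Graph_Theory"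
    "Jordan_Normal_Form.Char_Poly"
begin

(* A simple graph is a symmetric loop-free pair digraph: the edge {u, v} is the pair of arcs
   (u, v), (v, u). The signature is a function of the unordered pair; its values outside the
   edges are irrelevant. *)

record 'a sgraph =
  ground :: "'a pair_pre_digraph"
  sign :: "'a set \<Rightarrow> int"

(* Graphs are non-null. In particular the negation of the library's connectedness, which fails
   on the null graph, is disconnectedness, and a summand of a disjoint union is never empty. *)

locale signed_graph =
  fixes S :: "'a sgraph"
  assumes simple: "pair_graph (ground S)"
    and nonempty: "pverts (ground S) \<noteq> {}"
    and sign: "\<And>u v. (u, v) \<in> parcs (ground S) \<Longrightarrow> sign S {u, v} \<in> {-1, 1}"

definition adjacency_matrix :: "'a sgraph \<Rightarrow> 'a list \<Rightarrow> real mat" where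
  "adjacency_matrix S vs = mat (length vs) (length vs)
     (\<lambda>(i, j). if (vs ! i, vs ! j) \<in> parcs (ground S)
               then real_of_int (sign S {vs ! i, vs ! j}) else 0)"

(* Passing to the complex numbers makes the multiset have exactly as many elements as the
   dimension of the square matrix A. *)

definition eigenvalue_mset :: "real mat \<Rightarrow> complex multiset" where
  "eigenvalue_mset A = proots (char_poly (map_mat complex_of_real A))"

definition all_positive :: "'a pair_pre_digraph \<Rightarrow> 'a sgraph" where
  "all_positive G = \<lparr> ground = G, sign = (\<lambda>_. 1) \<rparr>"

definition negative :: "'a sgraph \<Rightarrow> 'a sgraph" where
  "negative S = S\<lparr> sign := (\<lambda>e. - sign S e) \<rparr>"

definition switch :: "'a set \<Rightarrow> 'a sgraph \<Rightarrow> 'a sgraph" where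
  "switch X S = S\<lparr> sign := (\<lambda>e. if e \<inter> X \<noteq> {} \<and> e - X \<noteq> {} then - sign S e else sign S e) \<rparr>"

definition signed_isomorphic :: "'a sgraph \<Rightarrow> 'b sgraph \<Rightarrow> bool" where
  "signed_isomorphic S T \<longleftrightarrow>
     (\<exists>f. bij_betw f (pverts (ground S)) (pverts (ground T)) \<and>
        (\<forall>u\<in>pverts (ground S). \<forall>v\<in>pverts (ground S).
           ((u, v) \<in> parcs (ground S) \<longleftrightarrow> (f u, f v) \<in> parcs (ground T)) \<and>
           ((u, v) \<in> parcs (ground S) \<longrightarrow> sign T {f u, f v} = sign S {u, v})))"

definition switching_isomorphic :: "'a sgraph \<Rightarrow> 'b sgraph \<Rightarrow> bool" where
  "switching_isomorphic S T \<longleftrightarrow>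
     (\<exists>X. X \<subseteq> pverts (ground S) \<and> signed_isomorphic (switch X S) T)"

definition is_disjoint_union :: "'a sgraph \<Rightarrow> 'a sgraph \<Rightarrow> 'a sgraph \<Rightarrow> bool" where
  "is_disjoint_union S S1 S2 \<longleftrightarrow>
     pverts (ground S1) \<inter> pverts (ground S2) = {} \<and>
     pverts (ground S) = pverts (ground S1) \<union> pverts (ground S2) \<and>
     parcs (ground S) = parcs (ground S1) \<union> parcs (ground S2) \<and>
     (\<forall>T\<in>{S1, S2}. \<forall>(u, v)\<in>parcs (ground T). sign S {u, v} = sign T {u, v})"

end

theory Submission
  imports Defs "Jordan_Normal_Form.Jordan_Normal_Form_Existence"
begin

text \<open>
  The adjacency matrix \<open>A\<close> is real symmetric, hence diagonalizable, so \<open>B = A\<^sup>2 - I\<close> has rank at most 2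
  and all its 3 by 3 minors vanish. \<open>B\<close> is block diagonal along the connected components, and its
  diagonal entry at a vertex is the degree minus 1. A component on which all of these entries
  vanish is an isolated edge; hence every block is nonzero, there are exactly two components, and each
  block has rank 1.

  Consider one component with \<open>n > 1\<close> vertices, of degrees \<open>d\<^sub>i\<close>, and keep the names \<open>A\<close> and \<open>B\<close> for the
  blocks. As \<open>B\<close> has rank 1 and commutes with \<open>A\<close>, its column space is spanned by an eigenvector of \<open>A\<close>,
  with eigenvalue \<open>\<theta>\<close> say, and connectedness gives \<open>d\<^sub>i \<ge> 2\<close> everywhere. Comparing traces,
  \<open>\<theta>\<^sup>2 - 1 = \<Sum>\<^sub>i (d\<^sub>i - 1)\<close>. The signed count of closed walks of length 3 at \<open>i\<close> is \<open>\<theta> (d\<^sub>i - 1)\<close>, and its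
  absolute value is at most \<open>d\<^sub>i (d\<^sub>i - 1)\<close>, so \<open>\<bar>\<theta>\<bar> \<le> d\<^sub>i \<le> n - 1\<close>. Then
  \<open>n (\<bar>\<theta>\<bar> - 1) \<le> \<theta>\<^sup>2 - 1\<close> yields \<open>n \<le> \<bar>\<theta>\<bar> + 1\<close>. Hence equality holds throughout: the component is
  complete and all its triangles have the sign of \<open>\<theta>\<close>, so switching at the negative (or positive)
  neighbours of one vertex makes all edges equal to that sign.
\<close>

section \<open>Diagonalization of real symmetric matrices over the complex numbers\<close>

text \<open>Pair both equations with \<open>p\<close>: by symmetry the matrix moves onto
  \<open>p\<close>, where it acts as \<open>cnj lam\<close>. If \<open>p\<close> is nonzero, the
  first pairing makes \<open>lam\<close> real; in the second the \<open>lam\<close> terms then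
  cancel and leave the squared norm of \<open>p\<close> equal to 0.\<close>

lemma symmetric_no_generalized_eigenvector:
  fixes a :: "'i \<Rightarrow> 'i \<Rightarrow> real" and p q :: "'i \<Rightarrow> complex"
  assumes "finite I"
    and sym: "\<And>i j. i \<in> I \<Longrightarrow> j \<in> I \<Longrightarrow> a i j = a j i"
    and p: "\<And>i. i \<in> I \<Longrightarrow> (\<Sum>k\<in>I. of_real (a i k) * p k) = lam * p i"
    and q: "\<And>i. i \<in> I \<Longrightarrow> (\<Sum>k\<in>I. of_real (a i k) * q k) = lam * q i + p i"
    and "i \<in> I"
  shows "p i = 0"
proof (rule ccontr)
  assume "p i \<noteq> 0"
  have form: "(\<Sum>i\<in>I. cnj (p i) * (\<Sum>k\<in>I. of_real (a i k) * f k)) = cnj lam * (\<Sum>k\<in>I. cnj (p k) * f k)"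
    for f :: "'i \<Rightarrow> complex"
  proof -
    have "(\<Sum>i\<in>I. cnj (p i) * (\<Sum>k\<in>I. of_real (a i k) * f k))
        = (\<Sum>i\<in>I. \<Sum>k\<in>I. cnj (p i) * of_real (a i k) * f k)"
      by (simp add: sum_distrib_left mult.assoc)
    also have "\<dots> = (\<Sum>k\<in>I. \<Sum>i\<in>I. cnj (p i) * of_real (a i k) * f k)"
      by (rule sum.swap)
    also have "\<dots> = (\<Sum>k\<in>I. cnj (\<Sum>i\<in>I. of_real (a k i) * p i) * f k)"
      by (intro sum.cong refl) (simp add: sum_distrib_right sum_distrib_left sym mult.commute)
    also have "\<dots> = (\<Sum>k\<in>I. cnj lam * (cnj (p k) * f k))"
      by (intro sum.cong refl) (simp add: p)
    finally show ?thesis by (simp add: sum_distrib_left)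
  qed
  define N where "N = (\<Sum>k\<in>I. cnj (p k) * p k)"
  have "N = of_real (\<Sum>k\<in>I. (cmod (p k))\<^sup>2)"
    unfolding N_def of_real_sum
    by (intro sum.cong refl) (metis complex_norm_square mult.commute)
  moreover have "(\<Sum>k\<in>I. (cmod (p k))\<^sup>2) > 0"
    using \<open>finite I\<close> \<open>i \<in> I\<close> \<open>p i \<noteq> 0\<close> by (intro sum_pos2[of I i]) auto
  ultimately have "N \<noteq> 0" by (metis less_irrefl of_real_eq_0_iff)
  have "lam * N = (\<Sum>i\<in>I. cnj (p i) * (\<Sum>k\<in>I. of_real (a i k) * p k))"
    by (simp add: p N_def sum_distrib_left mult.left_commute)
  then have real: "lam = cnj lam"
    using form[of p] \<open>N \<noteq> 0\<close> by (simp add: N_def)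
  have "(\<Sum>i\<in>I. cnj (p i) * (\<Sum>k\<in>I. of_real (a i k) * q k)) = lam * (\<Sum>k\<in>I. cnj (p k) * q k) + N"
    by (simp add: q N_def distrib_left sum.distrib sum_distrib_left mult.left_commute cong: sum.cong)
  then show False
    using form[of q] real \<open>N \<noteq> 0\<close> by simp
qed

text \<open>Breaks the block structure down to single entries, so that block boundaries need not be
  tracked later. A superdiagonal 1 lies inside one block, hence the equal diagonal entries.\<close>

lemma jordan_matrix_entry:
  assumes "i < sum_list (map fst n_as)" "j < sum_list (map fst n_as)"
  shows "(j \<noteq> i \<and> j \<noteq> Suc i \<longrightarrow> jordan_matrix n_as $$ (i, j) = 0) \<and>
    (j = Suc i \<longrightarrow> jordan_matrix n_as $$ (i, j) = 0 \<or>
       jordan_matrix n_as $$ (i, j) = 1 \<and> jordan_matrix n_as $$ (i, i) = jordan_matrix n_as $$ (j, j))"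
  using assms
proof (induction n_as arbitrary: i j)
  case (Cons na n_as)
  obtain n a where na: "na = (n, a)" by fastforce
  show ?case
  proof (cases "i < n")
    case True
    then show ?thesis using Cons.prems na by (auto simp: jordan_matrix_Cons)
  next
    case i: False
    show ?thesis
    proof (cases "j < n")
      case True
      then show ?thesis using i Cons.prems na by (auto simp: jordan_matrix_Cons)
    next
      case False
      have "jordan_matrix (na # n_as) $$ (x, y) = jordan_matrix n_as $$ (x - n, y - n)"
        if "x \<in> {i, j}" "y \<in> {i, j}" for x y
        using that i False Cons.prems na by (auto simp: jordan_matrix_Cons)
      moreover have "j - n = i - n \<longleftrightarrow> j = i" "j - n = Suc (i - n) \<longleftrightarrow> j = Suc i"
        "i - n < sum_list (map fst n_as)" "j - n < sum_list (map fst n_as)"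
        using i False Cons.prems na by auto
      ultimately show ?thesis
        using Cons.IH[of "i - n" "j - n"] by simp
    qed
  qed
qed simp

lemma proots_prod_list_linear: "proots (\<Prod>a\<leftarrow>as. [:- a, 1 :: 'a :: idom:]) = mset as"
proof (induction as)
  case (Cons a as)
  have "(\<Prod>a\<leftarrow>as. [:- a, 1:]) \<noteq> 0" by (auto simp: prod_list_zero_iff)
  then have "proots ([:- a, 1:] * (\<Prod>a\<leftarrow>as. [:- a, 1:])) = add_mset a (mset as)"
    by (subst proots_mult) (simp_all add: Cons)
  then show ?case by (simp only: list.map prod_list.Cons mset.simps)
qed simp

text \<open>Start from a Jordan form; symmetry rules out a superdiagonal 1. The diagonal then lists
  the eigenvalues with multiplicity.\<close>

lemma symmetric_diagonalizable:
  fixes A :: "real mat"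
  assumes A: "A \<in> carrier_mat n n"
    and sym: "\<And>i j. i < n \<Longrightarrow> j < n \<Longrightarrow> A $$ (i, j) = A $$ (j, i)"
  obtains D P Q where "similar_mat_wit (map_mat complex_of_real A) D P Q"
    and "\<And>i j. i < n \<Longrightarrow> j < n \<Longrightarrow> i \<noteq> j \<Longrightarrow> D $$ (i, j) = 0"
    and "eigenvalue_mset A = mset (diag_mat D)"
proof -
  let ?A = "map_mat complex_of_real A"
  have cA: "?A \<in> carrier_mat n n" using A by simp
  obtain as where "char_poly ?A = (\<Prod>a\<leftarrow>as. [:- a, 1:])"
    using char_poly_factorized[OF cA] by auto
  from jordan_nf_exists[OF cA this] obtain n_as where jnf: "jordan_nf ?A n_as" ..
  define D where "D = jordan_matrix n_as"
  obtain P Q where wit: "similar_mat_wit ?A D P Q"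
    using jnf by (auto simp: jordan_nf_def similar_mat_def D_def)
  from similar_mat_witD2[OF cA wit]
  have PQ: "P * Q = 1\<^sub>m n" "Q * P = 1\<^sub>m n" "?A = P * D * Q"
    and carr: "D \<in> carrier_mat n n" "P \<in> carrier_mat n n" "Q \<in> carrier_mat n n" by auto
  have n: "sum_list (map fst n_as) = n" using carr(1) by (auto simp: D_def)
  have AP: "?A * P = P * D"
    using PQ carr by (simp add: assoc_mult_mat[of _ n n _ n _ n])
  have col: "(\<Sum>k<n. of_real (A $$ (i, k)) * P $$ (k, j)) = (\<Sum>k<n. P $$ (i, k) * D $$ (k, j))"
    if "i < n" "j < n" for i j
    using arg_cong[OF AP, of "\<lambda>M. M $$ (i, j)"] that carr A
    by (simp add: scalar_prod_def atLeast0LessThan)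
  have super: "D $$ (c, Suc c) = 0" if "Suc c < n" for c
    using that
  proof (induction c rule: less_induct)
    case (less c)
    show ?case
    proof (rule ccontr)
      \<comment> \<open>Columns \<open>c\<close> and \<open>c + 1\<close> of \<open>P\<close> would be an eigenvector and a generalized eigenvector above it.\<close>
      assume "D $$ (c, Suc c) \<noteq> 0"
      then have one: "D $$ (c, Suc c) = 1" "D $$ (Suc c, Suc c) = D $$ (c, c)"
        using jordan_matrix_entry[of c n_as "Suc c"] less.prems by (auto simp: D_def n)
      \<comment> \<open>The only other possible entry of column \<open>c\<close> sits just above the
        diagonal and is 0 by induction, so column \<open>c\<close> of \<open>P\<close> is a true
        eigenvector.\<close>
      have z: "D $$ (k, c) = 0" if "k < n" "k \<noteq> c" for k
      proof (cases "c = Suc k")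
        case True
        then show ?thesis using less.IH[of k] less.prems by auto
      next
        case False
        then show ?thesis using jordan_matrix_entry[of k n_as c] that less.prems by (auto simp: D_def n)
      qed
      have z': "D $$ (k, Suc c) = 0" if "k < n" "k \<noteq> c" "k \<noteq> Suc c" for k
        using jordan_matrix_entry[of k n_as "Suc c"] that less.prems by (auto simp: D_def n)
      have "P $$ (i, c) = 0" if i: "i < n" for i
      proof (rule symmetric_no_generalized_eigenvector
          [of "{..<n}" "\<lambda>i j. A $$ (i, j)" "\<lambda>i. P $$ (i, c)" "D $$ (c, c)" "\<lambda>i. P $$ (i, Suc c)"])
        fix i assume i: "i \<in> {..<n}"
        have "(\<Sum>k<n. P $$ (i, k) * D $$ (k, c)) = (\<Sum>k\<in>{c}. P $$ (i, k) * D $$ (k, c))"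
          using less.prems by (intro sum.mono_neutral_right) (auto simp: z)
        then show "(\<Sum>k<n. of_real (A $$ (i, k)) * P $$ (k, c)) = D $$ (c, c) * P $$ (i, c)"
          using col i less.prems by simp
        have "(\<Sum>k<n. P $$ (i, k) * D $$ (k, Suc c)) = (\<Sum>k\<in>{c, Suc c}. P $$ (i, k) * D $$ (k, Suc c))"
          using less.prems by (intro sum.mono_neutral_right) (auto simp: z')
        then show "(\<Sum>k<n. of_real (A $$ (i, k)) * P $$ (k, Suc c))
            = D $$ (c, c) * P $$ (i, Suc c) + P $$ (i, c)"
          using col i less.prems one by simp
      qed (use i sym in auto)
      \<comment> \<open>A zero column of \<open>P\<close> contradicts the diagonal entry
        \<open>(c, c)\<close> of \<open>Q * P = 1\<^sub>m n\<close>.\<close>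
      then have "(\<Sum>k<n. Q $$ (c, k) * P $$ (k, c)) = 0" by simp
      moreover have "(\<Sum>k<n. Q $$ (c, k) * P $$ (k, c)) = 1"
        using arg_cong[OF PQ(2), of "\<lambda>M. M $$ (c, c)"] less.prems carr
        by (simp add: scalar_prod_def atLeast0LessThan)
      ultimately show False by simp
    qed
  qed
  have diag: "D $$ (i, j) = 0" if "i < n" "j < n" "i \<noteq> j" for i j
    using jordan_matrix_entry[of i n_as j] super[of i] that by (auto simp: D_def n)
  have "char_poly ?A = char_poly D"
    using wit by (intro char_poly_similar) (auto simp: similar_mat_def)
  also have "\<dots> = (\<Prod>a\<leftarrow>diag_mat D. [:- a, 1:])"
    using carr by (intro char_poly_upper_triangular) (auto simp: upper_triangular_def diag)
  finally have "eigenvalue_mset A = proots (\<Prod>a\<leftarrow>diag_mat D. [:- a, 1:])"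
    by (simp add: eigenvalue_mset_def)
  then have "eigenvalue_mset A = mset (diag_mat D)"
    by (simp add: proots_prod_list_linear)
  with wit diag show ?thesis by (rule that)
qed

section \<open>Rank of \<open>A\<^sup>2 - I\<close>\<close>

lemma card_le_2_cover:
  assumes "finite K" "card K \<le> 2"
  obtains k l where "K = {} \<or> K = {k} \<or> k \<noteq> l \<and> K = {k, l}"
  using assms that
  by (metis card_0_eq card_1_singletonE card_2_iff le_Suc_eq le_zero_eq numeral_2_eq_2 One_nat_def)

text \<open>In an eigenbasis \<open>A\<^sup>2 - I\<close> is diagonal with entries
  \<open>\<lambda>\<^sup>2 - 1\<close>, which vanish for eigenvalues 1 and -1. Each of the at most
  two others contributes one outer product of a column of \<open>P\<close> with a row of
  \<open>Q\<close>.\<close>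

lemma symmetric_square_minus_one_rank_le_2:
  fixes A :: "real mat"
  assumes A: "A \<in> carrier_mat n n"
    and sym: "\<And>i j. i < n \<Longrightarrow> j < n \<Longrightarrow> A $$ (i, j) = A $$ (j, i)"
    and eig: "size {# x \<in># eigenvalue_mset A. x \<noteq> 1 \<and> x \<noteq> -1 #} \<le> 2"
  obtains p q r s :: "nat \<Rightarrow> complex" where
    "\<And>i j. i < n \<Longrightarrow> j < n \<Longrightarrow>
       of_real ((A * A - 1\<^sub>m n) $$ (i, j)) = p i * q j + r i * s j"
proof -
  let ?A = "map_mat complex_of_real A"
  obtain D P Q where wit: "similar_mat_wit ?A D P Q"
    and diag: "\<And>i j. i < n \<Longrightarrow> j < n \<Longrightarrow> i \<noteq> j \<Longrightarrow> D $$ (i, j) = 0"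
    and mset: "eigenvalue_mset A = mset (diag_mat D)"
    using symmetric_diagonalizable[OF A sym] by blast
  have cA: "?A \<in> carrier_mat n n" using A by simp
  from similar_mat_witD2[OF cA wit]
  have PQ: "P * Q = 1\<^sub>m n" "Q * P = 1\<^sub>m n" "?A = P * D * Q"
    and carr: "D \<in> carrier_mat n n" "P \<in> carrier_mat n n" "Q \<in> carrier_mat n n" by auto
  \<comment> \<open>Positions rather than values of the exceptional eigenvalues, so that
    multiplicities are counted.\<close>
  define K where "K = {k. k < n \<and> D $$ (k, k) \<noteq> 1 \<and> D $$ (k, k) \<noteq> - 1}"
  have "card K = length (filter (\<lambda>x. x \<noteq> 1 \<and> x \<noteq> -1) (diag_mat D))"
    using carrier_matD(1)[OF carr(1)] by (auto simp: length_filter_conv_card K_def diag_mat_def intro!: arg_cong[of _ _ card])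
  also have "\<dots> \<le> 2" using eig unfolding mset by (metis mset_filter size_mset)
  finally obtain k l where K: "K = {} \<or> K = {k} \<or> k \<noteq> l \<and> K = {k, l}"
    using card_le_2_cover[of K] by (auto simp: K_def)
  define e where "e m = (D $$ (m, m))\<^sup>2 - 1" for m
  have e0: "e m = 0" if "m < n" "m \<notin> K" for m
    using that by (auto simp: K_def e_def power2_eq_1_iff)
  have sq: "map_mat complex_of_real (A * A - 1\<^sub>m n) = P * (D * D - 1\<^sub>m n) * Q"
  proof -
    have "map_mat complex_of_real (A * A - 1\<^sub>m n) = ?A * ?A - 1\<^sub>m n"
      using A by (auto simp: scalar_prod_def)
    also have "?A * ?A = P * (D * D) * Q"
      using similar_mat_wit_pow_id[OF wit, of 2] cA carr(1) by (simp add: numeral_2_eq_2)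
    also have "\<dots> - 1\<^sub>m n = P * (D * D) * Q - P * 1\<^sub>m n * Q"
      using PQ(1) by (simp only: right_mult_one_mat[OF carr(2)])
    also have "\<dots> = (P * (D * D) - P * 1\<^sub>m n) * Q"
      by (intro minus_mult_distrib_mat[symmetric, of _ n n _ _ n] mult_carrier_mat[of _ n n]
          one_carrier_mat carr)
    also have "P * (D * D) - P * 1\<^sub>m n = P * (D * D - 1\<^sub>m n)"
      by (intro mult_minus_distrib_mat[symmetric, of _ n n _ n] mult_carrier_mat[of _ n n]
          one_carrier_mat carr)
    finally show ?thesis .
  qed
  have entry: "of_real ((A * A - 1\<^sub>m n) $$ (i, j)) = (\<Sum>m\<in>K. P $$ (i, m) * e m * Q $$ (m, j))"
    if ij: "i < n" "j < n" for i j
  proof -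
    have DD: "(D * D - 1\<^sub>m n) $$ (x, m) = (if x = m then e m else 0)" if "x < n" "m < n" for x m
    proof -
      have "(\<Sum>k<n. D $$ (x, k) * D $$ (k, m)) = (\<Sum>k\<in>{x}. D $$ (x, k) * D $$ (k, m))"
        using that by (intro sum.mono_neutral_right) (auto simp: diag)
      then show ?thesis
        using that carr(1) diag[of x m] 
        by (auto simp: scalar_prod_def atLeast0LessThan e_def power2_eq_square)
    qed
    have PD: "(P * (D * D - 1\<^sub>m n)) $$ (i, m) = P $$ (i, m) * e m" if "m < n" for m
    proof -
      have "(P * (D * D - 1\<^sub>m n)) $$ (i, m) = (\<Sum>x<n. P $$ (i, x) * (D * D - 1\<^sub>m n) $$ (x, m))"
        using that ij carr by (simp add: scalar_prod_def atLeast0LessThan)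
      also have "\<dots> = (\<Sum>x<n. if x = m then P $$ (i, m) * e m else 0)"
        by (intro sum.cong refl) (simp add: DD that del: index_minus_mat(1))
      finally show ?thesis using that by simp
    qed
    have prod_entry: "(M * Q) $$ (i, j) = (\<Sum>m<n. M $$ (i, m) * Q $$ (m, j))"
      if "M \<in> carrier_mat n n" for M
      using that ij carr by (simp add: scalar_prod_def atLeast0LessThan)
    have "of_real ((A * A - 1\<^sub>m n) $$ (i, j)) = map_mat complex_of_real (A * A - 1\<^sub>m n) $$ (i, j)"
      using A ij by simp
    also have "\<dots> = (P * (D * D - 1\<^sub>m n) * Q) $$ (i, j)" by (simp only: sq)
    also have "\<dots> = (\<Sum>m<n. (P * (D * D - 1\<^sub>m n)) $$ (i, m) * Q $$ (m, j))"
      by (intro prod_entry mult_carrier_mat[of _ n n] minus_carrier_mat one_carrier_mat carr)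
    also have "\<dots> = (\<Sum>m<n. P $$ (i, m) * e m * Q $$ (m, j))"
      by (intro sum.cong refl) (simp add: PD del: index_mult_mat(1))
    also have "\<dots> = (\<Sum>m\<in>K. P $$ (i, m) * e m * Q $$ (m, j))"
      by (intro sum.mono_neutral_right) (auto simp: K_def e0[unfolded K_def])
    finally show ?thesis .
  qed
  consider "K = {}" | "K = {k}" | "k \<noteq> l" "K = {k, l}" using K by blast
  then show ?thesis
  proof cases
    case 1 then show ?thesis using that[of "\<lambda>_. 0" "\<lambda>_. 0" "\<lambda>_. 0" "\<lambda>_. 0"] entry by simp
  next
    case 2 then show ?thesis
      using that[of "\<lambda>i. P $$ (i, k) * e k" "\<lambda>j. Q $$ (k, j)" "\<lambda>_. 0" "\<lambda>_. 0"] entry by simp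
  next
    case 3 then show ?thesis
      using that[of "\<lambda>i. P $$ (i, k) * e k" "\<lambda>j. Q $$ (k, j)" "\<lambda>i. P $$ (i, l) * e l" "\<lambda>j. Q $$ (l, j)"] entry
      by simp
  qed
qed

section \<open>A single component: rank one forces completeness\<close>

text \<open>The one-component argument, for a function on a finite set. Connectedness is the absence
  of proper nonempty closed subsets; it is applied to a singleton and to the zero set of an
  eigenvector. The function \<open>s\<close> records the switching, \<open>e\<close> the common sign
  after it.\<close>

lemma signed_matrix_rank_one_complete:
  fixes a b :: "'a \<Rightarrow> 'a \<Rightarrow> real"
  assumes fin: "finite C"
    and sym: "\<And>i j. i \<in> C \<Longrightarrow> j \<in> C \<Longrightarrow> a i j = a j i"
    and vals: "\<And>i j. i \<in> C \<Longrightarrow> j \<in> C \<Longrightarrow> a i j \<in> {-1, 0, 1}"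
    and irrefl: "\<And>i. i \<in> C \<Longrightarrow> a i i = 0"
    and conn: "\<And>X. X \<subseteq> C \<Longrightarrow> X \<noteq> {} \<Longrightarrow>
        (\<And>i j. i \<in> X \<Longrightarrow> j \<in> C \<Longrightarrow> a i j \<noteq> 0 \<Longrightarrow> j \<in> X) \<Longrightarrow> X = C"
    and b: "\<And>i j. i \<in> C \<Longrightarrow> j \<in> C \<Longrightarrow> b i j = (\<Sum>k\<in>C. a i k * a k j) - (if i = j then 1 else 0)"
    and minor: "\<And>i j k l. i \<in> C \<Longrightarrow> j \<in> C \<Longrightarrow> k \<in> C \<Longrightarrow> l \<in> C \<Longrightarrow> b i j * b k l = b i l * b k j"
    and r: "r \<in> C" "b r r \<noteq> 0"
  shows "\<exists>e s. e \<in> {-1, 1} \<and> (\<forall>i\<in>C. s i \<in> {-1, 1}) \<and>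
           (\<forall>i\<in>C. \<forall>j\<in>C. i \<noteq> j \<longrightarrow> a i j = e * s i * s j)"
proof (cases "C = {r}")
  \<comment> \<open>A lone vertex has \<open>b r r = -1\<close>, so it meets the hypotheses; it has
    no pairs to check.\<close>
  case True
  then show ?thesis by (intro exI[of _ 1] exI[of _ "\<lambda>_. 1"]) auto
next
  case False
  define d where "d i = (\<Sum>j\<in>C. \<bar>a i j\<bar>)" for i
  have sq: "a i j * a i j = \<bar>a i j\<bar>" if "i \<in> C" "j \<in> C" for i j
    using vals[OF that] by auto
  have le1: "\<bar>a i j\<bar> \<le> 1" if "i \<in> C" "j \<in> C" for i j
    using vals[OF that] by auto
  have bd: "b i i = d i - 1" if "i \<in> C" for i
    using that by (simp add: b d_def sq sym[of _ i] cong: sum.cong)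
  have bsym: "b i j = b j i" if "i \<in> C" "j \<in> C" for i j
    using that by (simp add: b sym[of i] sym[of j] mult.commute cong: sum.cong)
  have sqr: "(\<Sum>k\<in>C. a i k * a k j) = b i j + (if i = j then 1 else 0)" if "i \<in> C" "j \<in> C" for i j
    using that by (simp add: b)
  \<comment> \<open>Both sides are the entry of \<open>a\<^sup>3 - a\<close>.\<close>
  have "(\<Sum>k\<in>C. a i k * b k j) = (\<Sum>k\<in>C. b i k * a k j)" if ij: "i \<in> C" "j \<in> C" for i j
  proof -
    have "(\<Sum>k\<in>C. a i k * b k j) = (\<Sum>k\<in>C. a i k * (\<Sum>l\<in>C. a k l * a l j)) - a i j"
      using ij fin by (simp add: b right_diff_distrib sum_subtractf if_distrib[of "(*) _"] cong: sum.cong)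
    also have "(\<Sum>k\<in>C. a i k * (\<Sum>l\<in>C. a k l * a l j)) = (\<Sum>l\<in>C. (\<Sum>k\<in>C. a i k * a k l) * a l j)"
      unfolding sum_distrib_left sum_distrib_right
      by (subst sum.swap) (simp add: mult.assoc)
    also have "\<dots> - a i j = (\<Sum>k\<in>C. b i k * a k j)"
      using ij fin
      by (simp add: b left_diff_distrib sum_subtractf if_distrib[of "\<lambda>x. x * _"] cong: sum.cong)
    finally show ?thesis .
  qed
  note comm = this
  \<comment> \<open>Up to scaling, the rank one matrix \<open>b = a\<^sup>2 - 1\<close> is the outer square of its column \<open>x\<close>;
    since \<open>a\<close> commutes with \<open>b\<close>, this column is an eigenvector of \<open>a\<close>.\<close>
  define x where "x i = b i r" for i
  define D where "D = b r r"
  have D: "D \<noteq> 0" using r by (simp add: D_def)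
  have bx: "b i j = x i * x j / D" if "i \<in> C" "j \<in> C" for i j
    using minor[of i j r r] bsym[of r j] that r D by (simp add: x_def D_def field_simps)
  have xx: "x i * x i = D * (d i - 1)" if "i \<in> C" for i
    using bx[OF that that] bd[OF that] D by (simp add: field_simps)
  \<comment> \<open>The factor that remains when \<open>x i\<close> is taken out of column
    \<open>r\<close> of \<open>b a\<close>, which equals column \<open>r\<close> of
    \<open>a b\<close>.\<close>
  define th where "th = (\<Sum>k\<in>C. x k * a k r) / D"
  have eig: "(\<Sum>k\<in>C. a i k * x k) = th * x i" if "i \<in> C" for i
  proof -
    have "(\<Sum>k\<in>C. a i k * x k) = (\<Sum>k\<in>C. b i k * a k r)"
      using comm[OF that r(1)] by (simp add: x_def)
    also have "\<dots> = (\<Sum>k\<in>C. x i / D * (x k * a k r))"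
      by (intro sum.cong refl) (simp add: bx that)
    also have "\<dots> = x i / D * (\<Sum>k\<in>C. x k * a k r)"
      by (simp only: sum_distrib_left)
    finally show ?thesis by (simp add: th_def)
  qed
  have brx: "b r l = x l" if "l \<in> C" for l
    using bsym[OF r(1) that] by (simp add: x_def)
  \<comment> \<open>Evaluate \<open>a\<^sup>2 x\<close> at \<open>r\<close> in two ways: as
    \<open>th\<^sup>2 * D\<close> by the eigenvalue equation, and as \<open>b x + x\<close>, where
    the squares \<open>x l * x l\<close> bring in the trace of \<open>b\<close>.\<close>
  have th_sq: "th\<^sup>2 - 1 = (\<Sum>i\<in>C. d i - 1)"
  proof -
    have "th\<^sup>2 * D = th * (\<Sum>k\<in>C. a r k * x k)"
      unfolding eig[OF r(1)] by (simp add: x_def D_def power2_eq_square)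
    also have "\<dots> = (\<Sum>k\<in>C. a r k * (th * x k))"
      by (simp add: sum_distrib_left mult.left_commute)
    also have "\<dots> = (\<Sum>k\<in>C. a r k * (\<Sum>l\<in>C. a k l * x l))"
      by (simp add: eig cong: sum.cong)
    also have "\<dots> = (\<Sum>l\<in>C. (\<Sum>k\<in>C. a r k * a k l) * x l)"
      unfolding sum_distrib_left sum_distrib_right
      by (subst sum.swap) (simp add: mult.assoc)
    also have "\<dots> = (\<Sum>l\<in>C. x l * x l + (if r = l then x l else 0))"
      by (intro sum.cong refl) (simp add: sqr[OF r(1)] brx distrib_right)
    also have "\<dots> = D * (\<Sum>i\<in>C. d i - 1) + D"
      using r fin by (simp add: sum.distrib xx sum_distrib_left[symmetric] cong: sum.cong)
        (simp add: x_def D_def)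
    finally have "D * (th\<^sup>2 - 1) = D * (\<Sum>i\<in>C. d i - 1)" by (simp add: algebra_simps)
    then show ?thesis using D by simp
  qed
  have tri: "(\<Sum>j\<in>C. \<Sum>k\<in>C. a i j * a j k * a k i) = th * (d i - 1)" if i: "i \<in> C" for i
  proof -
    have "(\<Sum>j\<in>C. \<Sum>k\<in>C. a i j * a j k * a k i) = (\<Sum>k\<in>C. (\<Sum>j\<in>C. a i j * a j k) * a k i)"
      unfolding sum_distrib_right by (rule sum.swap)
    \<comment> \<open>\<open>a\<^sup>2\<close> and \<open>b\<close> differ only at
      \<open>k = i\<close>, where the factor \<open>a k i\<close> is 0.\<close>
    also have "\<dots> = (\<Sum>k\<in>C. x i / D * (a i k * x k))"
    proof (intro sum.cong refl)
      fix k assume k: "k \<in> C"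
      then show "(\<Sum>j\<in>C. a i j * a j k) * a k i = x i / D * (a i k * x k)"
        unfolding sqr[OF i k] bx[OF i k] sym[OF k i] using irrefl[OF i] by auto
    qed
    also have "\<dots> = x i / D * (\<Sum>k\<in>C. a i k * x k)"
      by (simp only: sum_distrib_left)
    also have "\<dots> = th * (x i * x i) / D" using i by (simp add: eig)
    finally show ?thesis using i D by (simp add: xx)
  qed
  \<comment> \<open>Equals 1 if \<open>j\<close> and \<open>k\<close> are distinct neighbours of
    \<open>i\<close>, else 0. A closed walk of length 3 at \<open>i\<close> passes through such a
    pair, there being no loops.\<close>
  define g where "g i j k = \<bar>a i j\<bar> * \<bar>a i k\<bar> - (if k = j then \<bar>a i j\<bar> else 0)" for i j k
  have gsum: "(\<Sum>j\<in>C. \<Sum>k\<in>C. g i j k) = d i * (d i - 1)" if i: "i \<in> C" for i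
  proof -
    have "(\<Sum>j\<in>C. \<Sum>k\<in>C. g i j k) = (\<Sum>j\<in>C. \<bar>a i j\<bar> * d i - \<bar>a i j\<bar>)"
      using fin by (simp add: g_def sum_subtractf sum_distrib_left[symmetric] d_def[symmetric])
    also have "\<dots> = d i * d i - d i"
      by (simp add: sum_subtractf sum_distrib_right[symmetric] d_def[symmetric])
    finally show ?thesis by (simp add: algebra_simps)
  qed
  have gbound: "\<bar>a i j * a j k * a k i\<bar> \<le> g i j k" if "i \<in> C" "j \<in> C" "k \<in> C" for i j k
    using vals[of i j] vals[of j k] vals[of i k] sym[of k i] irrefl[of j] that by (auto simp: g_def)
  have deg_pos: "\<exists>j\<in>C. a i j \<noteq> 0" if "i \<in> C" for i
  proof (rule ccontr)
    assume "\<not> (\<exists>j\<in>C. a i j \<noteq> 0)"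
    then have "{i} = C" using that by (intro conn) auto
    then show False using False r by auto
  qed
  \<comment> \<open>Makes the degree an integer: excluding the values 0 and 1 will give at least
    2.\<close>
  have dcard: "d i = real (card {j\<in>C. a i j \<noteq> 0})" if "i \<in> C" for i
  proof -
    have "d i = (\<Sum>j\<in>C. if a i j \<noteq> 0 then 1 else 0)"
      unfolding d_def by (intro sum.cong refl) (use vals that in force)
    then show ?thesis using fin by (simp add: sum.If_cases Int_def)
  qed
  \<comment> \<open>A vertex where \<open>x\<close> vanishes has degree 1, and the eigenvalue equation there makes \<open>x\<close> vanish
    at its only neighbour as well.\<close>
  have xnz: "x i \<noteq> 0" if "i \<in> C" for i
  proof
    assume "x i = 0"
    have "{i\<in>C. x i = 0} = C"
    proof (rule conn)
      fix i j assume i: "i \<in> {i\<in>C. x i = 0}" and j: "j \<in> C" "a i j \<noteq> 0"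
      then have "d i = 1" using xx[of i] D by auto
      then have "card {j\<in>C. a i j \<noteq> 0} = 1" using dcard[of i] i by simp
      then obtain y where "{k\<in>C. a i k \<noteq> 0} = {y}" by (auto simp: card_1_singleton_iff)
      then have z: "a i k = 0" if "k \<in> C" "k \<noteq> j" for k 
        using that j by (metis (mono_tags, lifting) mem_Collect_eq singletonD)
      have "0 = (\<Sum>k\<in>C. a i k * x k)" using i by (simp add: eig)
      also have "\<dots> = (\<Sum>k\<in>{j}. a i k * x k)"
        using j z fin by (intro sum.mono_neutral_right) auto
      finally show "j \<in> {i\<in>C. x i = 0}" using j by simp
    qed (use that \<open>x i = 0\<close> in auto)
    then show False using r by (auto simp: x_def)
  qed
  have d2: "d i \<ge> 2" if "i \<in> C" for i
  proof -
    have "card {j\<in>C. a i j \<noteq> 0} \<noteq> 0" using deg_pos[OF that] fin by auto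
    moreover have "d i \<noteq> 1" using xx[OF that] xnz[OF that] by auto
    then have "card {j\<in>C. a i j \<noteq> 0} \<noteq> 1" using dcard[OF that] by auto
    ultimately show ?thesis using dcard[OF that] by simp
  qed
  define T n where "T = \<bar>th\<bar>" and "n = real (card C)"
  \<comment> \<open>The signed count of closed 3-walks is at most the number of ordered pairs of
    distinct neighbours; divide by \<open>d i - 1\<close>, which is positive.\<close>
  have Td: "T \<le> d i" if i: "i \<in> C" for i
  proof -
    have "T * (d i - 1) = \<bar>\<Sum>j\<in>C. \<Sum>k\<in>C. a i j * a j k * a k i\<bar>"
      using d2[OF i] by (simp add: tri[OF i] T_def abs_mult)
    also have "\<dots> \<le> (\<Sum>j\<in>C. \<Sum>k\<in>C. \<bar>a i j * a j k * a k i\<bar>)"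
      by (rule order.trans[OF sum_abs]) (intro sum_mono sum_abs)
    also have "\<dots> \<le> (\<Sum>j\<in>C. \<Sum>k\<in>C. g i j k)"
      using gbound i by (intro sum_mono) auto
    also have "\<dots> = d i * (d i - 1)" by (rule gsum[OF i])
    finally show ?thesis using d2[OF i] by (simp add: mult_le_cancel_right)
  qed
  \<comment> \<open>Writes \<open>n - 1\<close> as a sum over \<open>C\<close>, for termwise
    comparison with \<open>d i\<close>.\<close>
  have n_minus: "(\<Sum>j\<in>C. if j = i then 0 else 1) = n - 1" if "i \<in> C" for i
  proof -
    have "(\<Sum>j\<in>C. if j = i then 0 else 1) = (\<Sum>j\<in>C. 1 - (if j = i then 1 else 0 :: real))"
      by (intro sum.cong) auto
    then show ?thesis using that fin by (simp add: sum_subtractf n_def)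
  qed
  have a_le: "\<bar>a i j\<bar> \<le> (if j = i then 0 else 1)" if "i \<in> C" "j \<in> C" for i j
    using that irrefl le1 by auto
  have dn: "d i \<le> n - 1" if "i \<in> C" for i
    unfolding n_minus[OF that, symmetric] d_def using that a_le by (intro sum_mono) auto
  have "n > 0" using r fin by (auto simp: n_def card_gt_0_iff)
  \<comment> \<open>Used with \<open>c = 1\<close> to get \<open>T > 1\<close>, then with
    \<open>c = T - 1\<close>, where \<open>T - 1\<close> can be cancelled.\<close>
  have sum_ge: "n * c \<le> T\<^sup>2 - 1" if "\<And>i. i \<in> C \<Longrightarrow> c \<le> d i - 1" for c
    using sum_mono[of C "\<lambda>_. c" "\<lambda>i. d i - 1"] that th_sq by (simp add: T_def n_def)
  have "T\<^sup>2 > 1" using sum_ge[of 1] d2 \<open>n > 0\<close> by fastforce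
  then have "T > 1" by (metis T_def abs_ge_zero not_less power_le_one)
  moreover have "n * (T - 1) \<le> (T + 1) * (T - 1)"
    using sum_ge[of "T - 1"] Td by (simp add: power2_eq_square algebra_simps)
  ultimately have "n \<le> T + 1" by (simp add: mult_le_cancel_right)
  \<comment> \<open>The chain \<open>T \<le> d i \<le> n - 1 \<le> T\<close> collapses, so all the
    termwise bounds behind it are equalities.\<close>
  then have dT: "d i = T" "d i = n - 1" if "i \<in> C" for i
    using Td[OF that] dn[OF that] by auto
  have complete: "\<bar>a i j\<bar> = 1" if ij: "i \<in> C" "j \<in> C" "i \<noteq> j" for i j
  proof -
    have "(\<Sum>j\<in>C. (if j = i then 0 else 1) - \<bar>a i j\<bar>) = 0"
      using dT(2)[OF ij(1)] n_minus[OF ij(1)] by (simp add: sum_subtractf d_def)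
    then have "\<forall>j\<in>C. (if j = i then 0 else 1) - \<bar>a i j\<bar> = 0"
      using a_le ij fin by (subst (asm) sum_nonneg_eq_0_iff) auto
    then show ?thesis using ij by auto
  qed
  define e where "e = sgn th"
  have e: "e \<in> {-1, 1}" "e * th = T"
    using \<open>T > 1\<close> by (auto simp: e_def T_def sgn_if)
  have triangle: "a i j * a j k * a k i = e"
    if ijk: "i \<in> C" "j \<in> C" "k \<in> C" "i \<noteq> j" "i \<noteq> k" "j \<noteq> k" for i j k
  proof -
    \<comment> \<open>The factor \<open>e\<close> orients the walks towards the sign of
      \<open>th\<close>. These nonnegative gaps sum to 0, so each is 0.\<close>
    have nonneg: "g i j k - e * (a i j * a j k * a k i) \<ge> 0" if "j \<in> C" "k \<in> C" for j k
      using gbound[OF ijk(1) that] e(1) by auto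
    have "(\<Sum>j\<in>C. \<Sum>k\<in>C. g i j k - e * (a i j * a j k * a k i))
        = d i * (d i - 1) - e * (th * (d i - 1))"
      by (simp add: sum_subtractf sum_distrib_left[symmetric] gsum tri ijk)
    also have "\<dots> = 0" using e(2) dT(1)[OF ijk(1)] by (simp add: mult.assoc[symmetric])
    finally have "\<forall>j\<in>C. (\<Sum>k\<in>C. g i j k - e * (a i j * a j k * a k i)) = 0"
      using fin nonneg by (subst (asm) sum_nonneg_eq_0_iff) (auto intro!: sum_nonneg)
    then have "(\<Sum>k\<in>C. g i j k - e * (a i j * a j k * a k i)) = 0" using ijk by blast
    then have "\<forall>k\<in>C. g i j k - e * (a i j * a j k * a k i) = 0"
      by (subst (asm) sum_nonneg_eq_0_iff) (use fin nonneg ijk in auto)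
    then have "e * (a i j * a j k * a k i) = 1"
      using ijk complete by (auto simp: g_def)
    then show ?thesis using e(1) by auto
  qed
  \<comment> \<open>Normalized by \<open>s r = 1\<close>; the factor \<open>e\<close> gives
    \<open>a r i = e * s r * s i\<close>. For other pairs the triangle through \<open>r\<close>
    determines \<open>a i j\<close>, and the two factors \<open>e\<close> in
    \<open>s i * s j\<close> cancel.\<close>
  define s where "s i = (if i = r then 1 else e * a r i)" for i
  have ao: "a r i \<in> {-1, 1}" if "i \<in> C" "i \<noteq> r" for i
    using complete[OF r(1), of i] that by auto
  have "a i j = e * s i * s j" if ij: "i \<in> C" "j \<in> C" "i \<noteq> j" for i j
  proof -
    consider "i = r" | "j = r" | "i \<noteq> r" "j \<noteq> r" by blast
    then show ?thesis
    proof cases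
      case 1
      then show ?thesis using ij e(1) by (auto simp: s_def)
    next
      case 2
      then show ?thesis using ij e(1) sym[of i r] by (auto simp: s_def)
    next
      case 3
      then show ?thesis
        using triangle[OF r(1) ij(1,2)] ij e(1) ao[of i] ao[of j] sym[of j r] r(1) by (auto simp: s_def)
    qed
  qed
  moreover have "s i \<in> {-1, 1}" if "i \<in> C" for i
    using ao[OF that] e(1) by (auto simp: s_def)
  ultimately show ?thesis using e(1) by blast
qed

section \<open>From matrices to signed graphs\<close>

text \<open>A 3 by 3 determinant expanded along row \<open>i\<close>. It vanishes for a sum of two
  outer products by a polynomial identity, checked over the complex numbers because the factors are
  complex.\<close>

lemma rank_two_minor:
  fixes b :: "'i \<Rightarrow> 'j \<Rightarrow> real" and p r :: "'i \<Rightarrow> complex" and q s :: "'j \<Rightarrow> complex"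
  assumes "\<And>x y. x \<in> {i, k, m} \<Longrightarrow> y \<in> {j, l, n} \<Longrightarrow> of_real (b x y) = p x * q y + r x * s y"
  shows "b i j * (b k l * b m n - b k n * b m l) - b i l * (b k j * b m n - b k n * b m j)
       + b i n * (b k j * b m l - b k l * b m j) = 0" (is "?d = 0")
proof -
  have "complex_of_real ?d = 0"
    by (simp add: assms) (simp add: algebra_simps)
  then show ?thesis by (simp only: of_real_eq_0_iff)
qed

text \<open>The adjacency matrix indexed by vertices, free of any enumeration.\<close>

definition weight :: "'a sgraph \<Rightarrow> 'a \<Rightarrow> 'a \<Rightarrow> real" where
  "weight S u v = (if (u, v) \<in> parcs (ground S) then real_of_int (sign S {u, v}) else 0)"

definition square_minus_one :: "'a sgraph \<Rightarrow> 'a \<Rightarrow> 'a \<Rightarrow> real" where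
  "square_minus_one S u v =
     (\<Sum>w\<in>pverts (ground S). weight S u w * weight S w v) - (if u = v then 1 else 0)"

definition induced :: "'a sgraph \<Rightarrow> 'a set \<Rightarrow> 'a sgraph" where
  "induced S C = \<lparr> ground = \<lparr> pverts = C, parcs = parcs (ground S) \<inter> C \<times> C \<rparr>, sign = sign S \<rparr>"

text \<open>Switching at the vertices with \<open>s v = -1\<close> multiplies the sign of each edge
  by \<open>s i * s j\<close>, which leaves the constant \<open>e\<close>. Since all the products
  are nonzero, every pair of distinct vertices is an edge.\<close>

lemma switching_isomorphic_complete:
  fixes T :: "'a sgraph" and e :: real and s :: "'a \<Rightarrow> real"
  assumes T: "signed_graph T" and e: "e \<in> {-1, 1}"
    and s: "\<forall>i\<in>pverts (ground T). s i \<in> {-1, 1}"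
    and w: "\<forall>i\<in>pverts (ground T). \<forall>j\<in>pverts (ground T). i \<noteq> j \<longrightarrow> weight T i j = e * s i * s j"
  shows "\<exists>n (K :: nat pair_pre_digraph). complete_digraph n (with_proj K) \<and>
           (switching_isomorphic T (all_positive K) \<or> switching_isomorphic T (negative (all_positive K)))"
proof -
  define V where "V = pverts (ground T)"
  define n where "n = card V"
  define X where "X = {v\<in>V. s v = -1}"
  define K where "K = \<lparr> pverts = {..<n}, parcs = {(u, v). u < n \<and> v < n \<and> u \<noteq> v} \<rparr>"
  interpret pair_graph "ground T" using T by (simp add: signed_graph_def)
  obtain f where f: "bij_betw f V {..<n}"
    using ex_bij_betw_finite_nat[OF pair_finite_verts] by (auto simp: V_def n_def atLeast0LessThan)
  have arc: "(i, j) \<in> parcs (ground T) \<longleftrightarrow> i \<noteq> j" if "i \<in> V" "j \<in> V" for i j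
    using that w s e pair_no_loops[of "(i, j)"]
    by (force simp: V_def weight_def split: if_splits)
  have sgn: "real_of_int (sign T {i, j}) = e * s i * s j" if "i \<in> V" "j \<in> V" "i \<noteq> j" for i j
    using w[rule_format, of i j] arc[of i j] that by (simp add: V_def weight_def)
  have switched: "real_of_int (sign (switch X T) {i, j}) = e" if ij: "i \<in> V" "j \<in> V" "i \<noteq> j" for i j
  proof -
    have "s i \<in> {-1, 1}" "s j \<in> {-1, 1}" using s ij by (auto simp: V_def)
    moreover have "{i, j} \<inter> X \<noteq> {} \<and> {i, j} - X \<noteq> {} \<longleftrightarrow> (s i = -1) \<noteq> (s j = -1)"
      using ij by (auto simp: X_def)
    then have "real_of_int (sign (switch X T) {i, j}) =
        (if (s i = -1) \<noteq> (s j = -1) then - (e * s i * s j) else e * s i * s j)"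
      unfolding sgn[OF ij, symmetric] switch_def by simp
    ultimately show ?thesis by auto
  qed
  \<comment> \<open>Stated for any target with constant sign \<open>e\<close>, to serve both the
    positive and the negative complete graph.\<close>
  have iso: "switching_isomorphic T S'"
    if S': "ground S' = K" "\<And>e'. real_of_int (sign S' e') = e" for S' :: "nat sgraph"
    unfolding switching_isomorphic_def signed_isomorphic_def
  proof (intro exI[of _ X] conjI exI[of _ f] ballI impI)
    show "X \<subseteq> pverts (ground T)" by (auto simp: X_def V_def)
    show "bij_betw f (pverts (ground (switch X T))) (pverts (ground S'))"
      using f by (simp add: switch_def S' K_def V_def)
    fix i j assume ij: "i \<in> pverts (ground (switch X T))" "j \<in> pverts (ground (switch X T))"
    then have ij': "i \<in> V" "j \<in> V" by (auto simp: switch_def V_def)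
    then have "f i < n" "f j < n" "f i = f j \<longleftrightarrow> i = j"
      using f by (auto simp: bij_betw_def inj_on_eq_iff)
    then show "(i, j) \<in> parcs (ground (switch X T)) \<longleftrightarrow> (f i, f j) \<in> parcs (ground S')"
      using arc[OF ij'] by (auto simp: switch_def S' K_def)
    assume "(i, j) \<in> parcs (ground (switch X T))"
    then have "i \<noteq> j" using arc[OF ij'] by (simp add: switch_def)
    then have "real_of_int (sign (switch X T) {i, j}) = real_of_int (sign S' {f i, f j})"
      using switched ij' S'(2) by simp
    then show "sign S' {f i, f j} = sign (switch X T) {i, j}" by simp
  qed
  have "complete_digraph n (with_proj K)"
    by (auto simp: complete_digraph_pair_def K_def)
  moreover have "switching_isomorphic T (all_positive K) \<or> switching_isomorphic T (negative (all_positive K))"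
    using e iso[of "all_positive K"] iso[of "negative (all_positive K)"]
    by (auto simp: all_positive_def negative_def)
  ultimately show ?thesis by blast
qed

section \<open>Connected components of a signed graph\<close>

context signed_graph
begin

sublocale pair_graph "ground S" by (rule simple)

abbreviation "V \<equiv> pverts (ground S)"
abbreviation "reach \<equiv> reachable (with_proj (ground S))"
abbreviation "component u \<equiv> {v. reach u v}"

lemma arc_sym: "(u, v) \<in> parcs (ground S) \<longleftrightarrow> (v, u) \<in> parcs (ground S)"
  using pair_sym_arcs by (auto simp: symmetric_def sym_def)

lemma weight_sym: "weight S u v = weight S v u"
  by (auto simp: weight_def arc_sym insert_commute)

lemma weight_vals: "weight S u v \<in> {-1, 0, 1}"
  using sign[of u v] by (auto simp: weight_def)

lemma weight_eq_0_iff: "weight S u v = 0 \<longleftrightarrow> (u, v) \<notin> parcs (ground S)"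
  using sign[of u v] by (auto simp: weight_def)

lemma square_minus_one_rank_le_2:
  assumes vs: "distinct vs" "set vs = V"
    and eig: "size {# x \<in># eigenvalue_mset (adjacency_matrix S vs). x \<noteq> 1 \<and> x \<noteq> -1 #} \<le> 2"
  obtains p q r s :: "'a \<Rightarrow> complex" where
    "\<And>u v. u \<in> V \<Longrightarrow> v \<in> V \<Longrightarrow> of_real (square_minus_one S u v) = p u * q v + r u * s v"
proof -
  define n where "n = length vs"
  let ?A = "adjacency_matrix S vs"
  have A: "?A \<in> carrier_mat n n" by (simp add: adjacency_matrix_def n_def)
  have entry: "?A $$ (i, j) = weight S (vs ! i) (vs ! j)" if "i < n" "j < n" for i j
    using that by (simp add: adjacency_matrix_def n_def weight_def)
  have bij: "bij_betw ((!) vs) {..<n} V"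
    using bij_betw_nth[OF vs(1), of "{..<n}" V] vs(2) by (simp add: n_def)
  have sq: "(?A * ?A - 1\<^sub>m n) $$ (i, j) = square_minus_one S (vs ! i) (vs ! j)" if "i < n" "j < n" for i j
  proof -
    have "(?A * ?A) $$ (i, j) = (\<Sum>k<n. weight S (vs ! i) (vs ! k) * weight S (vs ! k) (vs ! j))"
      using that A by (simp add: scalar_prod_def atLeast0LessThan entry)
    also have "\<dots> = (\<Sum>w\<in>V. weight S (vs ! i) w * weight S w (vs ! j))"
      by (rule sum.reindex_bij_betw[OF bij])
    finally show ?thesis
      using that A vs(1) by (simp add: square_minus_one_def nth_eq_iff_index_eq n_def)
  qed
  obtain p q r s :: "nat \<Rightarrow> complex" where pqrs: "\<And>i j. i < n \<Longrightarrow> j < n \<Longrightarrow>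
       of_real ((?A * ?A - 1\<^sub>m n) $$ (i, j)) = p i * q j + r i * s j"
    using symmetric_square_minus_one_rank_le_2[OF A _ eig] entry weight_sym by metis
  define g where "g = the_inv_into {..<n} ((!) vs)"
  have g: "g u < n" "vs ! g u = u" if "u \<in> V" for u
    using the_inv_into_into[of "(!) vs" "{..<n}" u "{..<n}"] f_the_inv_into_f_bij_betw[OF bij, of u] bij that
    by (auto simp: g_def bij_betw_def)
  show ?thesis
    by (rule that[of "p \<circ> g" "q \<circ> g" "r \<circ> g" "s \<circ> g"]) (metis comp_apply g pqrs sq)
qed

lemma reach_sym: "reach u v \<Longrightarrow> reach v u"
  by (rule symmetric_reachable')

text \<open>Connectedness refers to the symmetric closure of the arcs, which changes nothing
  here.\<close>

lemma connected_iff_strongly_connected: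
  "Digraph_Component.connected (with_proj (ground S)) \<longleftrightarrow> strongly_connected (with_proj (ground S))"
proof -
  have "symcl (parcs (ground S)) = parcs (ground S)" using arc_sym by (auto simp: symcl_def)
  then show ?thesis by (simp add: connected_conv strongly_connected_def reachable_def)
qed

lemma component_subset: "component u \<subseteq> V"
  using reachable_in_verts by auto

lemma component_closed: "reach u v \<Longrightarrow> (v, w) \<in> parcs (ground S) \<Longrightarrow> reach u w"
  using reachable_adj_trans by auto

text \<open>A closed subset absorbs all that is reachable from one of its members, and by symmetry
  of reachability that is the whole component.\<close>

lemma component_minimal:
  assumes X: "X \<subseteq> component u" "X \<noteq> {}"
    and closed: "\<And>i j. i \<in> X \<Longrightarrow> j \<in> component u \<Longrightarrow> (i, j) \<in> parcs (ground S) \<Longrightarrow> j \<in> X"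
  shows "X = component u"
proof -
  obtain x where x: "x \<in> X" using X by blast
  have "y \<in> X" if "reach x y" for y
    using that
  proof (induction rule: reachable_induct)
    case (step y z)
    have "reach u y" using X step.IH by blast
    then have "reach u z" using step.hyps component_closed by auto
    then show ?case using closed[OF step.IH] step.hyps by auto
  qed (use x in auto)
  moreover have "reach x y" if "reach u y" for y
    using that X x reach_sym reachable_trans by blast
  ultimately show ?thesis using X by blast
qed

lemma square_minus_one_sym: "square_minus_one S u v = square_minus_one S v u"
  unfolding square_minus_one_def by (simp add: weight_sym[of u] weight_sym[of _ v] mult.commute)

text \<open>A walk of length 2 never leaves its component. This is the block diagonality of
  \<open>A\<^sup>2 - I\<close>.\<close>

lemma square_minus_one_across:
  assumes "u \<in> V" "reach u i" "\<not> reach u m"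
  shows "square_minus_one S i m = 0"
proof -
  have "weight S i w * weight S w m = 0" for w
    using assms component_closed[of u i w] component_closed[of u w m] by (auto simp: weight_eq_0_iff)
  then show ?thesis using assms by (auto simp: square_minus_one_def)
qed

text \<open>Zero diagonal entries mean that each vertex has exactly one neighbour, and then
  \<open>u\<close> and its neighbour form a closed set. An isolated vertex has entry -1
  instead.\<close>

lemma component_not_K2:
  assumes u: "u \<in> V"
    and noK2: "\<not> (\<exists>C \<in> pre_digraph.sccs (with_proj (ground S)). complete_digraph 2 C)"
  shows "\<exists>i\<in>component u. square_minus_one S i i \<noteq> 0"
proof (rule ccontr)
  assume contra: "\<not> ?thesis"
  have unique: "\<exists>j. {w\<in>V. (i, w) \<in> parcs (ground S)} = {j}" if "reach u i" for i
  proof -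
    have "1 = (\<Sum>w\<in>V. weight S i w * weight S w i)"
      using contra that by (simp add: square_minus_one_def)
    also have "\<dots> = (\<Sum>w\<in>V. if (i, w) \<in> parcs (ground S) then 1 else 0)"
      using sign by (intro sum.cong refl) (fastforce simp: weight_def arc_sym[of _ i] insert_commute[of _ i])
    also have "\<dots> = real (card {w\<in>V. (i, w) \<in> parcs (ground S)})"
      using pair_finite_verts by (simp add: sum.If_cases Int_def)
    finally show ?thesis by (simp add: card_1_singleton_iff)
  qed
  have ru: "reach u u" using u by simp
  obtain j where j: "{w\<in>V. (u, w) \<in> parcs (ground S)} = {j}" using unique[OF ru] by blast
  then have uj: "(u, j) \<in> parcs (ground S)" "j \<in> V" by blast+
  then have rj: "reach u j" using ru component_closed by blast
  have ju: "(j, u) \<in> parcs (ground S)" using uj arc_sym by blast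
  have j': "{w\<in>V. (j, w) \<in> parcs (ground S)} = {u}" 
    using unique[OF rj] ju u by (metis (mono_tags, lifting) mem_Collect_eq singletonD)
  have C: "{u, j} = component u"
    by (rule component_minimal) (use ru rj j j' component_subset in blast)+
  have ne: "u \<noteq> j" using pair_no_loops[OF uj(1)] by auto
  define H where "H = \<lparr> pverts = {u, j}, parcs = {(u, j), (j, u)} \<rparr>"
  have arcs: "{e \<in> parcs (ground S). fst e \<in> {u, j} \<and> snd e \<in> {u, j}} = {(u, j), (j, u)}"
    using uj ju pair_no_loops by fastforce
  have "induce_subgraph (with_proj (ground S)) (component u) = with_proj H"
    unfolding C[symmetric] using arcs by (simp add: induce_subgraph_def H_def with_proj_def)
  moreover have "complete_digraph 2 (with_proj H)"
    unfolding complete_digraph_pair_def using ne by (auto simp: H_def)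
  ultimately show False
    using noK2 induce_reachable_is_in_sccs[of u] u by auto
qed

lemma signed_graph_induced_component:
  assumes u: "u \<in> V"
  shows "signed_graph (induced S (component u))"
proof (rule signed_graph.intro)
  show "pair_graph (ground (induced S (component u)))"
  proof
    show "finite (pverts (ground (induced S (component u))))"
      using finite_subset[OF component_subset pair_finite_verts] by (simp add: induced_def)
    show "finite (parcs (ground (induced S (component u))))"
      using pair_finite_arcs by (simp add: induced_def)
    show "symmetric (with_proj (ground (induced S (component u))))"
      using arc_sym by (auto simp: symmetric_def sym_def induced_def)
  qed (use pair_no_loops in \<open>auto simp: induced_def\<close>)
  show "pverts (ground (induced S (component u))) \<noteq> {}" using u by (auto simp: induced_def)
qed (use sign in \<open>auto simp: induced_def\<close>)

text \<open>The component of \<open>v\<close> supplies a nonzero diagonal entry at some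
  \<open>m\<close>. Bordering a 2 by 2 minor of the component of \<open>u\<close> with row and
  column \<open>m\<close> multiplies it by that entry; the 3 by 3 minor vanishes, hence so does the
  smaller one.\<close>

lemma induced_component_switching_complete:
  assumes uv: "u \<in> V" "v \<in> V" "\<not> reach u v"
    and noK2: "\<not> (\<exists>C \<in> pre_digraph.sccs (with_proj (ground S)). complete_digraph 2 C)"
    and rank: "\<And>x y. x \<in> V \<Longrightarrow> y \<in> V \<Longrightarrow> of_real (square_minus_one S x y) = p x * q y + r x * (s y :: complex)"
  shows "\<exists>n (K :: nat pair_pre_digraph). complete_digraph n (with_proj K) \<and>
           (switching_isomorphic (induced S (component u)) (all_positive K) \<or>
            switching_isomorphic (induced S (component u)) (negative (all_positive K)))"
proof -
  let ?b = "square_minus_one S"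
  obtain m where m: "reach v m" "?b m m \<noteq> 0" using component_not_K2[OF uv(2) noK2] by blast
  have um: "\<not> reach u m" using m(1) uv(3) reach_sym reachable_trans by blast
  have mV: "m \<in> V" using m(1) component_subset by blast
  obtain i0 where i0: "i0 \<in> component u" "?b i0 i0 \<noteq> 0" using component_not_K2[OF uv(1) noK2] by blast
  have "\<exists>e t. e \<in> {-1, 1} \<and> (\<forall>i\<in>component u. t i \<in> {-1, 1}) \<and>
           (\<forall>i\<in>component u. \<forall>j\<in>component u. i \<noteq> j \<longrightarrow> weight S i j = e * t i * t j)"
  proof (rule signed_matrix_rank_one_complete[where b = ?b and r = i0])
    show "finite (component u)" using finite_subset[OF component_subset pair_finite_verts] .
    show "weight S i i = 0" for i using pair_no_loops[of "(i, i)"] by (auto simp: weight_eq_0_iff)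
    show "X = component u" if "X \<subseteq> component u" "X \<noteq> {}"
      "\<And>i j. i \<in> X \<Longrightarrow> j \<in> component u \<Longrightarrow> weight S i j \<noteq> 0 \<Longrightarrow> j \<in> X" for X
      using that by (intro component_minimal) (auto simp: weight_eq_0_iff)
    show "?b i j = (\<Sum>k\<in>component u. weight S i k * weight S k j) - (if i = j then 1 else 0)"
      if "i \<in> component u" "j \<in> component u" for i j
    proof -
      have "(\<Sum>k\<in>V. weight S i k * weight S k j) = (\<Sum>k\<in>component u. weight S i k * weight S k j)"
        using that component_closed component_subset pair_finite_verts
        by (intro sum.mono_neutral_right) (auto simp: weight_eq_0_iff)
      then show ?thesis by (simp add: square_minus_one_def)
    qed
    show "?b i j * ?b k l = ?b i l * ?b k j"
      if C: "i \<in> component u" "j \<in> component u" "k \<in> component u" "l \<in> component u" for i j k l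
    proof -
      have z: "?b x m = 0" "?b m x = 0" if "x \<in> component u" for x
        using square_minus_one_across[OF uv(1) _ um, of x] square_minus_one_sym[of m x] that by auto
      have "?b i j * (?b k l * ?b m m - ?b k m * ?b m l) - ?b i l * (?b k j * ?b m m - ?b k m * ?b m j)
          + ?b i m * (?b k j * ?b m l - ?b k l * ?b m j) = 0"
        by (rule rank_two_minor[of i k m j l m]) (rule rank; use C mV component_subset in blast)
      then have "(?b i j * ?b k l - ?b i l * ?b k j) * ?b m m = 0"
        using z C by (simp add: algebra_simps)
      then show ?thesis using m(2) by simp
    qed
  qed (use i0 weight_sym weight_vals in blast)+
  then obtain e t where et: "e \<in> {-1, 1}" "\<forall>i\<in>component u. t i \<in> {-1, 1}"
    "\<forall>i\<in>component u. \<forall>j\<in>component u. i \<noteq> j \<longrightarrow> weight S i j = e * t i * t j" by blast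
  have "weight (induced S (component u)) i j = weight S i j" if "i \<in> component u" "j \<in> component u" for i j
    using that by (simp add: weight_def induced_def)
  then show ?thesis
    using et by (intro switching_isomorphic_complete[OF signed_graph_induced_component[OF uv(1)], of e t])
      (auto simp: induced_def)
qed

text \<open>With a third component, nonzero diagonal entries from three different blocks would form
  a diagonal, nonsingular 3 by 3 minor.\<close>

lemma components_cover:
  assumes uv: "u \<in> V" "v \<in> V" "\<not> reach u v"
    and noK2: "\<not> (\<exists>C \<in> pre_digraph.sccs (with_proj (ground S)). complete_digraph 2 C)"
    and rank: "\<And>x y. x \<in> V \<Longrightarrow> y \<in> V \<Longrightarrow> of_real (square_minus_one S x y) = p x * q y + r x * (s y :: complex)"
  shows "V = component u \<union> component v"
proof (rule ccontr)
  assume "V \<noteq> component u \<union> component v"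
  then obtain w where w: "w \<in> V" "\<not> reach u w" "\<not> reach v w" using component_subset by blast
  let ?b = "square_minus_one S"
  obtain i j k where ijk: "reach u i" "reach v j" "reach w k" and nz: "?b i i \<noteq> 0" "?b j j \<noteq> 0" "?b k k \<noteq> 0"
    using component_not_K2[OF _ noK2] uv w by (metis mem_Collect_eq)
  have "\<not> reach u j" "\<not> reach u k" "\<not> reach v k"
    using ijk uv w reach_sym reachable_trans by blast+
  then have "?b i j = 0" "?b i k = 0" "?b j k = 0"
    using square_minus_one_across uv ijk by blast+
  then have z: "?b i j = 0" "?b i k = 0" "?b j k = 0" "?b j i = 0" "?b k i = 0" "?b k j = 0"
    using square_minus_one_sym by metis+
  have "?b i i * (?b j j * ?b k k - ?b j k * ?b k j) - ?b i j * (?b j i * ?b k k - ?b j k * ?b k i)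
      + ?b i k * (?b j i * ?b k j - ?b j j * ?b k i) = 0"
    by (rule rank_two_minor[of i j k i j k]) (rule rank; use ijk component_subset in blast)
  then show False using z nz by simp
qed

end

section \<open>Splitting the graph into its two components\<close>

theorem theorem2p4:
  fixes S :: "'a sgraph" and vs :: "'a list"
  assumes "signed_graph S"
    and "distinct vs" and "set vs = pverts (ground S)"
    and "size {# x \<in># eigenvalue_mset (adjacency_matrix S vs). x \<noteq> 1 \<and> x \<noteq> -1 #} \<le> 2"
    and "\<not> Digraph_Component.connected (with_proj (ground S))"
    and "\<not> (\<exists>C \<in> pre_digraph.sccs (with_proj (ground S)). complete_digraph 2 C)"
  shows "\<exists>S1 S2. signed_graph S1 \<and> signed_graph S2 \<and> is_disjoint_union S S1 S2 \<and>
           (\<forall>T\<in>{S1, S2}. \<exists>n (K :: nat pair_pre_digraph). complete_digraph n (with_proj K) \<and>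
              (switching_isomorphic T (all_positive K) \<or>
               switching_isomorphic T (negative (all_positive K))))"
proof -
  interpret signed_graph S by fact
  obtain p q r s :: "'a \<Rightarrow> complex" where rank:
    "\<And>u v. u \<in> V \<Longrightarrow> v \<in> V \<Longrightarrow> of_real (square_minus_one S u v) = p u * q v + r u * s v"
    using square_minus_one_rank_le_2[OF assms(2-4)] by blast
  have "\<not> strongly_connected (with_proj (ground S))"
    using assms(5) by (simp add: connected_iff_strongly_connected)
  \<comment> \<open>Strong connectedness also fails for an empty vertex set; as the graph is
    non-null, an unreachable pair must exist.\<close>
  then obtain u v where uv: "u \<in> V" "v \<in> V" "\<not> reach u v"
    using nonempty by (auto simp: strongly_connected_def)
  then have vu: "\<not> reach v u" using reach_sym by blast
  have cover: "V = component u \<union> component v"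
    by (rule components_cover[OF uv assms(6) rank])
  have disj: "component u \<inter> component v = {}"
    using uv(3) reach_sym reachable_trans by blast
  have arcs: "parcs (ground S) = parcs (ground S) \<inter> component u \<times> component u
      \<union> parcs (ground S) \<inter> component v \<times> component v"
  proof -
    have "reach u x \<and> reach u y \<or> reach v x \<and> reach v y" if "(x, y) \<in> parcs (ground S)" for x y
      using that cover in_arcsD1[OF that] component_closed by blast
    then show ?thesis by auto
  qed
  have "is_disjoint_union S (induced S (component u)) (induced S (component v))"
    unfolding is_disjoint_union_def using cover disj arcs by (simp add: induced_def)
  then show ?thesis
    using signed_graph_induced_component uv
      induced_component_switching_complete[OF uv assms(6) rank]
      induced_component_switching_complete[OF uv(2,1) vu assms(6) rank]
    by (intro exI[of _ "induced S (component u)"] exI[of _ "induced S (component v)"]) simp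
qed

end
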